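(* Let $p$ be a prime with $p\equiv 1\pmod 4$. In any Welch-Costas array of order $p-1$, the numbers of even/even, odd/odd, even/odd and odd/even dots satisfy $\#(e,e)=\#(o,o)=\#(e,o)=\#(o,e)=(p-1)/4$.
   Context: For an odd prime $p$, let $\Omega=\{1,2,\dots,p-1\}$. Given a generator $\alpha$ of $\mathbb{F}_p^*$ and any $c\in\mathbb{F}_p^*$, define the permutation $\sigma_{\alpha,c}$ of $\Omega$ by $\sigma_{\alpha,c}(i)=j$, where $j\in\Omega$ satisfies $c\alpha^i\equiv j\pmod p$. The Welch-Costas array of order $p-1$ associated with $(\alpha,c)$ is the $(p-1)\times(p-1)$ array with a dot in position $(i,\sigma_{\alpha,c}(i))$ (row $i$, column $\sigma_{\alpha,c}(i)$) for each $i\in\Omega$. A dot in row $i$, column $j$ is even/even if $i,j$ are both even, odd/odd if both are odd, even/odd if $i$ is even and $j$ odd, odd/even if $i$ is odd and $j$ even; $\#(e,e)$ etc. denote the respective counts. *)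

theory Defs
  imports "HOL-Number_Theory.Number_Theory"
begin

text \<open>Elements of the multiplicative group of the field with \<open>p\<close> elements are represented by
  their residues in \<open>{1..p - 1}\<close>; that \<open>\<alpha>\<close> generates the group is \<^term>\<open>residue_primroot p \<alpha>\<close>.\<close>

definition welch_perm :: "nat \<Rightarrow> nat \<Rightarrow> nat \<Rightarrow> nat \<Rightarrow> nat" where
  "welch_perm p \<alpha> c i = (THE j. j \<in> {1..p - 1} \<and> [c * \<alpha> ^ i = j] (mod p))"

text \<open>An array is represented by the set of positions (row, column) of its dots.\<close>

definition welch_costas_dots :: "nat \<Rightarrow> nat \<Rightarrow> nat \<Rightarrow> (nat \<times> nat) set" where
  "welch_costas_dots p \<alpha> c = {(i, welch_perm p \<alpha> c i) | i. i \<in> {1..p - 1}}"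

text \<open>\<open>is_welch_costas p A\<close>: \<open>A\<close> is a Welch-Costas array of order \<open>p - 1\<close>.\<close>

definition is_welch_costas :: "nat \<Rightarrow> (nat \<times> nat) set \<Rightarrow> bool" where
  "is_welch_costas p A \<longleftrightarrow>
     prime p \<and> odd p \<and>
     (\<exists>\<alpha> c. \<alpha> \<in> {1..p - 1} \<and> residue_primroot p \<alpha> \<and> c \<in> {1..p - 1} \<and>
            A = welch_costas_dots p \<alpha> c)"

definition num_ee :: "(nat \<times> nat) set \<Rightarrow> nat" where
  "num_ee A = card {(i, j) \<in> A. even i \<and> even j}"

definition num_oo :: "(nat \<times> nat) set \<Rightarrow> nat" where
  "num_oo A = card {(i, j) \<in> A. odd i \<and> odd j}"

definition num_eo :: "(nat \<times> nat) set \<Rightarrow> nat" where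
  "num_eo A = card {(i, j) \<in> A. even i \<and> odd j}"

definition num_oe :: "(nat \<times> nat) set \<Rightarrow> nat" where
  "num_oe A = card {(i, j) \<in> A. odd i \<and> even j}"

lemma welch_perm_eq_mod:
  assumes "prime p" "\<alpha> \<in> {1..p - 1}" "c \<in> {1..p - 1}"
  shows "welch_perm p \<alpha> c i = c * \<alpha> ^ i mod p"
    and "c * \<alpha> ^ i mod p \<in> {1..p - 1}"
proof -
  have "\<not> p dvd \<alpha>" "\<not> p dvd c"
    using assms by (auto dest!: dvd_imp_le)
  then have "\<not> p dvd c * \<alpha> ^ i"
    using assms(1) by (auto simp: prime_dvd_mult_iff dest: prime_dvd_power)
  moreover have "c * \<alpha> ^ i mod p < p"
    using assms(1) prime_gt_0_nat by auto
  ultimately show *: "c * \<alpha> ^ i mod p \<in> {1..p - 1}"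
    by (auto simp: dvd_eq_mod_eq_0)
  show "welch_perm p \<alpha> c i = c * \<alpha> ^ i mod p"
    unfolding welch_perm_def
  proof (rule the_equality)
    show "c * \<alpha> ^ i mod p \<in> {1..p - 1} \<and> [c * \<alpha> ^ i = c * \<alpha> ^ i mod p] (mod p)"
      using * by (simp add: cong_def)
  next
    fix j assume "j \<in> {1..p - 1} \<and> [c * \<alpha> ^ i = j] (mod p)"
    then have "j < p" "c * \<alpha> ^ i mod p = j mod p" by (auto simp: cong_def)
    then show "j = c * \<alpha> ^ i mod p" by simp
  qed
qed

end

theory Submission
  imports Defs
begin

text \<open>Since \<open>\<alpha> ^ ((p - 1) / 2) \<equiv> -1\<close>, shifting a row by the half period \<open>(p - 1) / 2\<close> turns
  column \<open>j\<close> into \<open>p - j\<close>, of the opposite parity. For \<open>p \<equiv> 1 (mod 4)\<close> the half period is even, so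
  the shift keeps the parity of the row: among the \<open>(p - 1) / 2\<close> rows of a given parity, exactly half
  have their dot in an even column.\<close>

text \<open>The square of \<open>\<alpha> ^ h\<close> is 1 modulo p, so \<open>\<alpha> ^ h\<close>
  is 1 or -1 in the field. The value 1 is excluded because \<open>\<alpha>\<close> has order
  \<open>2 * h\<close>, which cannot divide the smaller positive exponent \<open>h\<close>.\<close>

lemma prime_dvd_primroot_half_power_plus_1:
  fixes p \<alpha> h :: nat
  assumes p: "prime p" and prim: "residue_primroot p \<alpha>" and h: "p = 2 * h + 1"
  shows "p dvd \<alpha> ^ h + 1"
proof -
  have ord: "ord p \<alpha> = 2 * h"
    using prim p h by (auto simp: residue_primroot_def totient_prime)
  have "h > 0" using p h by (cases h) auto
  have "[\<alpha> ^ (2 * h) = 1] (mod p)" using ord_works[of \<alpha> p] ord by auto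
  then have "int p dvd int \<alpha> ^ (2 * h) - 1"
    by (metis cong_iff_dvd_diff cong_int_iff of_nat_1 of_nat_power)
  also have "int \<alpha> ^ (2 * h) - 1 = (int \<alpha> ^ h - 1) * (int \<alpha> ^ h + 1)"
    by (simp add: algebra_simps power_mult power2_eq_square)
  finally have "int p dvd int \<alpha> ^ h - 1 \<or> int p dvd int \<alpha> ^ h + 1"
    using p by (simp add: prime_dvd_mult_iff)
  moreover have "\<not> int p dvd int \<alpha> ^ h - 1"
  proof
    assume "int p dvd int \<alpha> ^ h - 1"
    then have "[\<alpha> ^ h = 1] (mod p)"
      by (metis cong_iff_dvd_diff cong_int_iff of_nat_1 of_nat_power)
    then have "2 * h dvd h" by (simp only: ord_divides ord)
    then show False using \<open>h > 0\<close> by (auto dest: dvd_imp_le)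
  qed
  ultimately have "int p dvd int (\<alpha> ^ h + 1)" by (simp add: add.commute)
  then show ?thesis by (simp only: of_nat_dvd_iff)
qed

lemma card_parity_class:
  "card {i \<in> {1..4 * k :: nat}. even i = P} = 2 * k"
proof (cases P)
  case True
  then have "{i \<in> {1..4 * k}. even i = P} = (\<lambda>i. 2 * i) ` {1..2 * k}"
    by (auto elim!: evenE)
  then show ?thesis by (simp add: card_image inj_on_def)
next
  case False
  then have "{i \<in> {1..4 * k}. even i = P} = (\<lambda>i. 2 * i + 1) ` {..<2 * k}"
    by (auto elim!: oddE)
  then show ?thesis by (simp add: card_image inj_on_def)
qed

text \<open>Cyclic shift of the rows by the even number \<open>2 * k\<close> pairs rows with
  \<open>f\<close> even and rows with \<open>f\<close> odd inside one row parity class. The two sets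
  are therefore equally large, and together they have \<open>2 * k\<close> elements.\<close>

lemma card_parity_class_half_shift:
  fixes f :: "nat \<Rightarrow> nat"
  assumes flip: "\<And>i. i \<in> {1..2 * k} \<Longrightarrow> even (f (i + 2 * k)) \<longleftrightarrow> odd (f i)"
  shows "card {i \<in> {1..4 * k}. even i = P \<and> even (f i) = Q} = k"
proof -
  define S where "S = (\<lambda>Q. {i \<in> {1..4 * k}. even i = P \<and> even (f i) = Q})"
  \<comment> \<open>Addition of \<open>2 * k\<close> modulo \<open>4 * k\<close>, with
    representatives 1 to \<open>4 * k\<close>; it is its own inverse.\<close>
  define s where "s = (\<lambda>i. if i \<le> 2 * k then i + 2 * k else i - 2 * k)"
  have s: "s i \<in> S (\<not> R)" "s (s i) = i" if "i \<in> S R" for i R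
  proof -
    have "s i \<in> {1..4 * k} \<and> even (s i) = even i \<and> even (f (s i)) = odd (f i)"
    proof (cases "i \<le> 2 * k")
      case True
      then show ?thesis using that flip[of i] by (auto simp: s_def S_def)
    next
      case False
      \<comment> \<open>The hypothesis speaks only of the lower half, so it is applied to
        \<open>s i\<close>, whose shift is \<open>i\<close>.\<close>
      then have "i - 2 * k \<in> {1..2 * k}" "i - 2 * k + 2 * k = i"
        using that by (auto simp: S_def)
      then show ?thesis using False flip[of "i - 2 * k"] by (auto simp: s_def)
    qed
    then show "s i \<in> S (\<not> R)" using that by (auto simp: S_def)
    show "s (s i) = i" using that by (auto simp: s_def S_def)
  qed
  have "bij_betw s (S Q) (S (\<not> Q))"
    by (rule bij_betw_byWitness[where f' = s]) (use s[of _ Q] s[of _ "\<not> Q"] in auto)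
  then have "card (S Q) = card (S (\<not> Q))" by (rule bij_betw_same_card)
  moreover have "card (S Q) + card (S (\<not> Q)) = card (S Q \<union> S (\<not> Q))"
    by (rule card_Un_disjoint[symmetric]) (auto simp: S_def)
  moreover have "S Q \<union> S (\<not> Q) = {i \<in> {1..4 * k}. even i = P}"
    by (auto simp: S_def)
  ultimately show ?thesis using card_parity_class[of k P] by (simp add: S_def)
qed

text \<open>The Booleans \<open>P\<close> and \<open>Q\<close> treat all four kinds of dots at
  once.\<close>

lemma card_welch_costas_parity_class:
  fixes p \<alpha> c :: nat
  assumes p: "prime p" "p = 4 * k + 1" and prim: "residue_primroot p \<alpha>"
    and \<alpha>: "\<alpha> \<in> {1..p - 1}" and c: "c \<in> {1..p - 1}"
  shows "card {(i, j) \<in> welch_costas_dots p \<alpha> c. even i = P \<and> even j = Q} = k"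
proof -
  define f where "f = welch_perm p \<alpha> c"
  have f: "f i = c * \<alpha> ^ i mod p" "f i \<in> {1..p - 1}" for i
    using welch_perm_eq_mod[OF p(1) \<alpha> c] by (auto simp: f_def)
  have "even (f (i + 2 * k)) \<longleftrightarrow> odd (f i)" for i
  proof -
    have "p dvd \<alpha> ^ (2 * k) + 1"
      using prime_dvd_primroot_half_power_plus_1[OF p(1) prim] p(2) by simp
    then have "p dvd c * \<alpha> ^ i * (\<alpha> ^ (2 * k) + 1)" by (rule dvd_mult)
    then have "p dvd c * \<alpha> ^ (i + 2 * k) + c * \<alpha> ^ i"
      by (simp add: algebra_simps power_add)
    then have "p dvd f (i + 2 * k) + f i"
      unfolding f(1) by (simp add: dvd_eq_mod_eq_0 mod_simps)
    then obtain m where m: "f (i + 2 * k) + f i = p * m" by (elim dvdE)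
    \<comment> \<open>Both columns lie between 1 and \<open>p - 1\<close>, so the only multiple of
      \<open>p\<close> their sum can be is \<open>p\<close> itself, which is odd.\<close>
    moreover have "0 < f (i + 2 * k) + f i" "f (i + 2 * k) + f i < p * 2"
      using f(2)[of i] f(2)[of "i + 2 * k"] by auto
    ultimately have "m = 1" by (cases m) auto
    then have "odd (f (i + 2 * k) + f i)" using m p(2) by simp
    then show ?thesis by simp
  qed
  then have "card {i \<in> {1..4 * k}. even i = P \<and> even (f i) = Q} = k"
    by (intro card_parity_class_half_shift) auto
  \<comment> \<open>The dots form the graph of \<open>f\<close>, so counting dots amounts to
    counting rows.\<close>
  moreover have "{(i, j) \<in> welch_costas_dots p \<alpha> c. even i = P \<and> even j = Q} =
      (\<lambda>i. (i, f i)) ` {i \<in> {1..4 * k}. even i = P \<and> even (f i) = Q}"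
    using p(2) by (auto simp: welch_costas_dots_def f_def)
  ultimately show ?thesis by (simp add: card_image inj_on_def)
qed

theorem theorem11:
  fixes p :: nat and A :: "(nat \<times> nat) set"
  assumes "prime p" and "[p = 1] (mod 4)" and "is_welch_costas p A"
  shows "num_ee A = num_oo A \<and> num_oo A = num_eo A \<and> num_eo A = num_oe A \<and>
         real (num_oe A) = (real p - 1) / 4"
proof -
  \<comment> \<open>Since \<open>p\<close> leaves remainder 1 modulo 4, this integer quotient is
    exactly (p - 1)/4.\<close>
  define k where "k = p div 4"
  have k: "p = 4 * k + 1"
    using assms(2) div_mult_mod_eq[of p 4] by (simp add: cong_def k_def)
  obtain \<alpha> c where "\<alpha> \<in> {1..p - 1}" "residue_primroot p \<alpha>" "c \<in> {1..p - 1}"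
    and A: "A = welch_costas_dots p \<alpha> c"
    using assms(3) by (auto simp: is_welch_costas_def)
  then have card: "card {(i, j) \<in> A. even i = P \<and> even j = Q} = k" for P Q
    unfolding A using assms(1) k by (intro card_welch_costas_parity_class)
  have "num_ee A = k" "num_oo A = k" "num_eo A = k" "num_oe A = k"
    using card[of True True] card[of False False] card[of True False] card[of False True]
    by (simp_all add: num_ee_def num_oo_def num_eo_def num_oe_def)
  then show ?thesis using k by simp
qed

end
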